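(* Let $G=(V,E)$ be a connected graph and $c:V\to\mathbb{N}$ with $c_v\le d(v)$ for every $v\in V$, where $d(v)$ is the degree of $v$ in $G$. Run the following Edge Addition algorithm: start with $Y=\emptyset$; for each $e\in E$ (in any order), if $Y\cup\{e\}$ is feasible, replace $Y$ by $Y\cup\{e\}$. Let $d_Y(x)$ be the degree of $x$ in $(V,Y)$ and $A=\{v\in V: d_Y(v)<c_v\}$. Let $Z$ be obtained by selecting, for each $v\in A$, arbitrary $c_v-d_Y(v)$ edges of $E\setminus Y$ incident on $v$ and inserting them into $Z$ (initially $Z=\emptyset$). Output $Y$ if $|Y|\ge |Z|$ and $Z$ otherwise. Then this algorithm is a $4$-approximation algorithm for PDBEP: its output is feasible and has cardinality at least $\mathrm{OPT}/4$, where $\mathrm{OPT}$ is the maximum cardinality of a feasible set.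
   Context: Partial Degree Bounded Edge Packing (PDBEP): given a graph $G=(V,E)$ and $c:V\to\mathbb{N}$, a set $E'\subseteq E$ is feasible if for every edge $(u,v)\in E'$ we have $d'_u\le c_u$ or $d'_v\le c_v$, where $d'_x$ denotes the degree of $x$ in $(V,E')$. The problem asks for a feasible set of maximum cardinality $\mathrm{OPT}$. *)

theory Defs
  imports Complex_Main
begin

definition simple_graph :: "'a set \<Rightarrow> 'a set set \<Rightarrow> bool" where
  "simple_graph V E \<longleftrightarrow> finite V \<and> (\<forall>e\<in>E. e \<subseteq> V \<and> card e = 2)"

definition connected_graph :: "'a set \<Rightarrow> 'a set set \<Rightarrow> bool" where
  "connected_graph V E \<longleftrightarrow> simple_graph V E \<and> (\<forall>u\<in>V. \<forall>v\<in>V. (\<lambda>x y. {x, y} \<in> E)\<^sup>*\<^sup>* u v)"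

definition incident :: "'a set set \<Rightarrow> 'a \<Rightarrow> 'a set set" where
  "incident F v = {e \<in> F. v \<in> e}"

definition degree :: "'a set set \<Rightarrow> 'a \<Rightarrow> nat" where
  "degree F v = card (incident F v)"

definition feasible :: "'a set set \<Rightarrow> ('a \<Rightarrow> nat) \<Rightarrow> 'a set set \<Rightarrow> bool" where
  "feasible E c F \<longleftrightarrow>
     F \<subseteq> E \<and> (\<forall>u v. {u, v} \<in> F \<longrightarrow> degree F u \<le> c u \<or> degree F v \<le> c v)"

definition OPT :: "'a set set \<Rightarrow> ('a \<Rightarrow> nat) \<Rightarrow> nat" where
  "OPT E c = Max {card F | F. feasible E c F}"

text \<open>The list \<open>es\<close> gives the order in which the edges are processed.\<close>

definition edge_addition :: "'a set set \<Rightarrow> ('a \<Rightarrow> nat) \<Rightarrow> 'a set list \<Rightarrow> 'a set set" where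
  "edge_addition E c es =
     foldl (\<lambda>Y e. if feasible E c (insert e Y) then insert e Y else Y) {} es"

definition deficient :: "'a set \<Rightarrow> ('a \<Rightarrow> nat) \<Rightarrow> 'a set set \<Rightarrow> 'a set" where
  "deficient V c Y = {v \<in> V. degree Y v < c v}"

text \<open>
  The arbitrary choices are resolved by a function: \<open>pick v S k\<close> is the set of
  \<open>k\<close> edges that the vertex \<open>v\<close> selects from \<open>S\<close>. It is constrained only when \<open>S\<close>
  has at least \<open>k\<close> elements, so such functions always exist. As \<open>pick\<close> may depend
  on \<open>v\<close> in any way, every family of choices for the vertices of a graph arises
  from some \<open>pick\<close>.
\<close>

definition selector :: "('a \<Rightarrow> 'a set set \<Rightarrow> nat \<Rightarrow> 'a set set) \<Rightarrow> bool" where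
  "selector pick \<longleftrightarrow>
     (\<forall>v S k. finite S \<and> k \<le> card S \<longrightarrow> pick v S k \<subseteq> S \<and> card (pick v S k) = k)"

definition complement_selection ::
  "'a set \<Rightarrow> 'a set set \<Rightarrow> ('a \<Rightarrow> nat) \<Rightarrow> ('a \<Rightarrow> 'a set set \<Rightarrow> nat \<Rightarrow> 'a set set)
     \<Rightarrow> 'a set set \<Rightarrow> 'a set set" where
  "complement_selection V E c pick Y =
     (\<Union>v\<in>deficient V c Y. pick v (incident (E - Y) v) (c v - degree Y v))"

definition pdbep_algorithm ::
  "'a set \<Rightarrow> 'a set set \<Rightarrow> ('a \<Rightarrow> nat) \<Rightarrow> 'a set list
     \<Rightarrow> ('a \<Rightarrow> 'a set set \<Rightarrow> nat \<Rightarrow> 'a set set) \<Rightarrow> 'a set set" where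
  "pdbep_algorithm V E c es pick =
     (let Y = edge_addition E c es;
          Z = complement_selection V E c pick Y
      in if card Y \<ge> card Z then Y else Z)"

end

theory Submission imports Defs begin

text \<open>
  Every edge of a feasible set \<open>F\<close> has an endpoint \<open>v\<close> with at most \<open>c v\<close> incident edges
  in \<open>F\<close>, so \<open>OPT \<le> (\<Sum>v\<in>V. c v)\<close>. By maximality of \<open>Y\<close>, no edge outside \<open>Y\<close> joins
  two deficient vertices. Hence the selections of distinct deficient vertices are disjoint,
  which makes \<open>Z\<close> feasible with \<open>card Z\<close> equal to the total deficiency. Therefore
  \<open>(\<Sum>v\<in>V. c v) \<le> card Z + (\<Sum>v\<in>V. degree Y v) = card Z + 2 * card Y\<close>,
  which even gives the ratio 3.
\<close>

section \<open>Finite simple graphs and vertex degrees\<close>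

lemma simple_graph_finite_edges:
  assumes "simple_graph V E"
  shows "finite E"
proof (rule finite_subset)
  show "E \<subseteq> Pow V" "finite (Pow V)"
    using assms by (auto simp: simple_graph_def)
qed

lemma simple_graph_edgeE:
  assumes "simple_graph V E" "e \<in> E"
  obtains u v where "e = {u, v}" "u \<noteq> v" "u \<in> V" "v \<in> V"
proof -
  have "e \<subseteq> V" "card e = 2"
    using assms by (auto simp: simple_graph_def)
  then show thesis
    using that by (auto simp: card_2_iff)
qed

lemma simple_graph_subset: "simple_graph V E \<Longrightarrow> F \<subseteq> E \<Longrightarrow> simple_graph V F"
  by (auto simp: simple_graph_def)

lemma finite_incident: "finite F \<Longrightarrow> finite (incident F v)"
  by (simp add: incident_def)

lemma degree_mono: "finite G \<Longrightarrow> F \<subseteq> G \<Longrightarrow> degree F v \<le> degree G v"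
  unfolding degree_def incident_def by (intro card_mono) auto

lemma degree_insert_le: "finite F \<Longrightarrow> degree (insert e F) v \<le> Suc (degree F v)"
proof -
  assume "finite F"
  have "incident (insert e F) v \<subseteq> insert e (incident F v)"
    by (auto simp: incident_def)
  then have "degree (insert e F) v \<le> card (insert e (incident F v))"
    unfolding degree_def using \<open>finite F\<close> by (intro card_mono) (auto simp: finite_incident)
  also have "\<dots> \<le> Suc (degree F v)"
    unfolding degree_def using \<open>finite F\<close> by (simp add: card_insert_if finite_incident)
  finally show ?thesis .
qed

lemma degree_insert_other: "v \<notin> e \<Longrightarrow> degree (insert e F) v = degree F v"
  unfolding degree_def incident_def by (rule arg_cong[where f = card]) auto

lemma degree_Diff:
  assumes "finite E" "Y \<subseteq> E"
  shows "degree (E - Y) v = degree E v - degree Y v"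
proof -
  have "incident (E - Y) v = incident E v - incident Y v"
    by (auto simp: incident_def)
  moreover have "finite (incident Y v)"
    using assms finite_subset by (intro finite_incident) blast
  moreover have "incident Y v \<subseteq> incident E v"
    using assms by (auto simp: incident_def)
  ultimately show ?thesis
    unfolding degree_def by (simp add: card_Diff_subset)
qed

text \<open>Handshake lemma, by double counting the pairs of a vertex and an edge containing
  it.\<close>

lemma sum_degree:
  assumes "simple_graph V E"
  shows "(\<Sum>v\<in>V. degree E v) = 2 * card E"
  unfolding degree_def incident_def
proof (rule sum_multicount)
  show "finite V" "finite E"
    using assms simple_graph_finite_edges by (auto simp: simple_graph_def)
  have "{v \<in> V. v \<in> e} = e" if "e \<in> E" for e
    using assms that by (auto simp: simple_graph_def)
  then show "\<forall>e\<in>E. card {v \<in> V. v \<in> e} = 2"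
    using assms by (simp add: simple_graph_def)
qed

section \<open>Feasible sets and an upper bound on \<open>OPT\<close>\<close>

lemma feasible_empty: "feasible E c {}"
  by (simp add: feasible_def)

text \<open>Dropping edges only lowers degrees. This is what makes a rejection in the greedy loop
  final.\<close>

lemma feasible_subset:
  assumes "finite E" "feasible E c G" "F \<subseteq> G"
  shows "feasible E c F"
proof -
  have "finite G"
    using assms finite_subset by (auto simp: feasible_def)
  then have "degree F v \<le> degree G v" for v
    using assms(3) by (rule degree_mono)
  then show ?thesis
    using assms(2,3) unfolding feasible_def by (meson order_trans subsetD)
qed

text \<open>Charge each edge of \<open>F\<close> to an endpoint whose degree in \<open>F\<close>
  respects its bound; such a vertex \<open>v\<close> is charged at most \<open>degree F v\<close>,
  hence at most \<open>c v\<close>, times.\<close>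

lemma card_feasible_le_sum:
  assumes G: "simple_graph V E" and F: "feasible E c F"
  shows "card F \<le> (\<Sum>v\<in>V. c v)"
proof -
  let ?S = "{v \<in> V. degree F v \<le> c v}"
  have "F \<subseteq> E" "finite F" "finite V"
    using F G simple_graph_finite_edges finite_subset
    by (auto simp: feasible_def simple_graph_def)
  have "F \<subseteq> (\<Union>v\<in>?S. incident F v)"
  proof
    fix e assume "e \<in> F"
    then obtain u v where "e = {u, v}" "u \<in> V" "v \<in> V"
      using simple_graph_edgeE[OF G] \<open>F \<subseteq> E\<close> by blast
    moreover have "degree F u \<le> c u \<or> degree F v \<le> c v"
      using F \<open>e \<in> F\<close> \<open>e = {u, v}\<close> by (simp add: feasible_def)
    ultimately show "e \<in> (\<Union>v\<in>?S. incident F v)"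
      using \<open>e \<in> F\<close> by (auto simp: incident_def)
  qed
  then have "card F \<le> card (\<Union>v\<in>?S. incident F v)"
    using \<open>finite F\<close> \<open>finite V\<close> by (intro card_mono) (auto simp: finite_incident)
  also have "\<dots> \<le> (\<Sum>v\<in>?S. degree F v)"
    unfolding degree_def using \<open>finite V\<close> by (intro card_UN_le) auto
  also have "\<dots> \<le> (\<Sum>v\<in>?S. c v)"
    by (intro sum_mono) auto
  also have "\<dots> \<le> (\<Sum>v\<in>V. c v)"
    using \<open>finite V\<close> by (intro sum_mono2) auto
  finally show ?thesis .
qed

lemma OPT_le_sum:
  assumes "simple_graph V E"
  shows "OPT E c \<le> (\<Sum>v\<in>V. c v)"
proof -
  \<comment> \<open>\<open>Max\<close> yields a genuine maximum only over a finite nonempty set; the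
    empty edge set provides a member.\<close>
  have "finite {F. feasible E c F}"
    by (rule finite_subset[of _ "Pow E"])
      (use simple_graph_finite_edges[OF assms] in \<open>auto simp: feasible_def\<close>)
  then have "finite {card F |F. feasible E c F}"
    by simp
  moreover have "{card F |F. feasible E c F} \<noteq> {}"
    using feasible_empty by blast
  ultimately show ?thesis
    unfolding OPT_def using card_feasible_le_sum[OF assms] by (auto simp: Max_le_iff)
qed

section \<open>Greedy edge addition and its maximality\<close>

lemma edge_addition_maximal:
  assumes "finite E"
  shows "feasible E c (edge_addition E c es) \<and>
    (\<forall>e \<in> set es - edge_addition E c es. \<not> feasible E c (insert e (edge_addition E c es)))"
proof (induction es rule: rev_induct)
  case Nil
  then show ?case by (simp add: edge_addition_def feasible_empty)
next
  case (snoc x xs)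
  let ?Y = "edge_addition E c xs"
  have step: "edge_addition E c (xs @ [x]) =
      (if feasible E c (insert x ?Y) then insert x ?Y else ?Y)"
    by (simp add: edge_addition_def)
  show ?case
  proof (cases "feasible E c (insert x ?Y)")
    case True
    \<comment> \<open>An edge rejected earlier stays rejected after \<open>?Y\<close> grows:
      otherwise \<open>insert e ?Y\<close> would be feasible as a subset of a feasible set.\<close>
    have "\<not> feasible E c (insert e (insert x ?Y))" if "e \<in> set xs - ?Y" for e
      using feasible_subset[OF assms, of c "insert e (insert x ?Y)" "insert e ?Y"] snoc that
      by blast
    then show ?thesis
      using True by (auto simp: step)
  next
    case False
    then show ?thesis
      using snoc by (auto simp: step)
  qed
qed

text \<open>One new edge raises a degree by at most one, and a deficient vertex has room for that.
  Edges touching \<open>u\<close> or \<open>v\<close> are thus satisfied there; at all other edges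
  no endpoint degree changes.\<close>

lemma feasible_insert_deficient:
  assumes "finite E" "feasible E c Y" "{u, v} \<in> E"
    and "u \<in> deficient V c Y" "v \<in> deficient V c Y"
  shows "feasible E c (insert {u, v} Y)"
proof -
  have "finite Y"
    using assms finite_subset by (auto simp: feasible_def)
  have endpoint: "degree (insert {u, v} Y) x \<le> c x" if "x \<in> {u, v}" for x
    using degree_insert_le[OF \<open>finite Y\<close>, of "{u, v}" x] assms(4,5) that
    by (auto simp: deficient_def)
  have "degree (insert {u, v} Y) a \<le> c a \<or> degree (insert {u, v} Y) b \<le> c b"
    if "{a, b} \<in> insert {u, v} Y" for a b
  proof (cases "a \<in> {u, v} \<or> b \<in> {u, v}")
    case True
    then show ?thesis using endpoint by blast
  next
    case False
    then have "{a, b} \<in> Y"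
      using that by (metis insertE insertI1)
    then show ?thesis
      using False assms(2) by (auto simp: degree_insert_other feasible_def)
  qed
  then show ?thesis
    using assms by (auto simp: feasible_def)
qed

section \<open>The selections made by deficient vertices\<close>

lemma selector_pick:
  assumes "selector pick" "finite S" "k \<le> card S"
  shows "pick v S k \<subseteq> S" "card (pick v S k) = k"
  using assms by (auto simp: selector_def)

context
  fixes V :: "'a set" and E Y :: "'a set set" and c :: "'a \<Rightarrow> nat"
    and pick :: "'a \<Rightarrow> 'a set set \<Rightarrow> nat \<Rightarrow> 'a set set"
  assumes graph: "simple_graph V E"
    and c_le: "\<And>v. v \<in> V \<Longrightarrow> c v \<le> degree E v"
    and Y: "feasible E c Y"
    and maximal: "\<And>e. e \<in> E - Y \<Longrightarrow> \<not> feasible E c (insert e Y)"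
    and pick: "selector pick"
begin

abbreviation "selection v \<equiv> pick v (incident (E - Y) v) (c v - degree Y v)"

lemma finite_E: "finite E"
  using graph by (rule simple_graph_finite_edges)

text \<open>A selector is constrained only when enough edges are available. The bound
  \<open>c v \<le> degree E v\<close> guarantees this: \<open>v\<close> has
  \<open>degree E v - degree Y v\<close> incident edges outside \<open>Y\<close>.\<close>

lemma selection:
  assumes "v \<in> V"
  shows "selection v \<subseteq> incident (E - Y) v" "card (selection v) = c v - degree Y v"
proof -
  have "Y \<subseteq> E"
    using Y by (simp add: feasible_def)
  then have "c v - degree Y v \<le> card (incident (E - Y) v)"
    using c_le[OF assms] degree_Diff[OF finite_E] by (simp add: degree_def[symmetric] diff_le_mono)
  moreover have "finite (incident (E - Y) v)"
    using finite_E by (simp add: finite_incident)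
  ultimately show "selection v \<subseteq> incident (E - Y) v" "card (selection v) = c v - degree Y v"
    using selector_pick[OF pick] by blast+
qed

text \<open>An edge outside \<open>Y\<close> with two deficient endpoints could still be added to
  \<open>Y\<close>, against maximality.\<close>

lemma deficient_endpoint_unique:
  assumes "e \<in> E - Y" "u \<in> e" "v \<in> e" "u \<in> deficient V c Y" "v \<in> deficient V c Y"
  shows "u = v"
proof (rule ccontr)
  assume "u \<noteq> v"
  then have "e = {u, v}"
    using assms(1-3) simple_graph_edgeE[OF graph, of e] by blast
  then show False
    using feasible_insert_deficient[OF finite_E Y] maximal assms by blast
qed

text \<open>An edge at \<open>v\<close> picked by another deficient vertex would have two deficient
  endpoints. So the degree of \<open>v\<close> in the union is exactly the number of edges that
  \<open>v\<close> itself requested.\<close>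

lemma incident_complement_selection:
  assumes "v \<in> deficient V c Y"
  shows "incident (complement_selection V E c pick Y) v = selection v"
proof -
  have "e \<in> selection v"
    if "u \<in> deficient V c Y" "e \<in> selection u" "v \<in> e" for u e
  proof -
    have "e \<in> incident (E - Y) u"
      using selection(1)[of u] that by (auto simp: deficient_def)
    then have "u = v"
      using deficient_endpoint_unique[of e u v] that assms by (auto simp: incident_def)
    then show ?thesis using that by simp
  qed
  moreover have "v \<in> e" if "e \<in> selection v" for e
    using selection(1)[of v] assms that by (auto simp: deficient_def incident_def)
  ultimately show ?thesis
    unfolding complement_selection_def incident_def[of "\<Union> _"] using assms by blast
qed

text \<open>The deficient vertex that picked an edge serves as its good endpoint: its degree in
  \<open>?Z\<close> is \<open>c v - degree Y v\<close>, which is at most \<open>c v\<close>.\<close>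

lemma feasible_complement_selection: "feasible E c (complement_selection V E c pick Y)"
proof -
  let ?Z = "complement_selection V E c pick Y"
  have edge: "e \<in> E - Y \<and> (\<exists>v\<in>e. degree ?Z v \<le> c v)" if "e \<in> ?Z" for e
  proof -
    from that obtain v where v: "v \<in> deficient V c Y" "e \<in> selection v"
      by (auto simp: complement_selection_def)
    then have "v \<in> V" by (simp add: deficient_def)
    have "degree ?Z v \<le> c v"
      using incident_complement_selection[OF v(1)] selection(2)[OF \<open>v \<in> V\<close>]
      by (simp add: degree_def)
    then show ?thesis
      using selection(1)[OF \<open>v \<in> V\<close>] v by (auto simp: incident_def)
  qed
  have "degree ?Z u \<le> c u \<or> degree ?Z v \<le> c v" if "{u, v} \<in> ?Z" for u v
    using edge[OF that] by auto
  moreover have "?Z \<subseteq> E"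
    using edge by auto
  ultimately show ?thesis
    by (simp add: feasible_def)
qed

lemma card_complement_selection:
  "card (complement_selection V E c pick Y) = (\<Sum>v\<in>V. c v - degree Y v)"
proof -
  let ?A = "deficient V c Y"
  have "finite V" "?A \<subseteq> V"
    using graph by (auto simp: simple_graph_def deficient_def)
  have sub: "selection v \<subseteq> incident (E - Y) v" if "v \<in> ?A" for v
    using that selection(1) \<open>?A \<subseteq> V\<close> by blast
  have "card (complement_selection V E c pick Y) = (\<Sum>v\<in>?A. card (selection v))"
    unfolding complement_selection_def
  proof (rule card_UN_disjoint)
    show "finite ?A"
      using \<open>finite V\<close> \<open>?A \<subseteq> V\<close> by (rule rev_finite_subset)
    show "\<forall>v\<in>?A. finite (selection v)"
      using sub finite_incident[of "E - Y"] finite_E finite_subset by blast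
    show "\<forall>u\<in>?A. \<forall>v\<in>?A. u \<noteq> v \<longrightarrow> selection u \<inter> selection v = {}"
    proof (intro ballI impI)
      fix u v assume "u \<in> ?A" "v \<in> ?A" "u \<noteq> v"
      then have "incident (E - Y) u \<inter> incident (E - Y) v = {}"
        using deficient_endpoint_unique by (auto simp: incident_def)
      then show "selection u \<inter> selection v = {}"
        using sub \<open>u \<in> ?A\<close> \<open>v \<in> ?A\<close> by blast
    qed
  qed
  also have "\<dots> = (\<Sum>v\<in>?A. c v - degree Y v)"
    using selection(2) \<open>?A \<subseteq> V\<close> by (intro sum.cong) auto
  \<comment> \<open>Truncated subtraction gives 0 at the vertices that are not deficient.\<close>
  also have "\<dots> = (\<Sum>v\<in>V. c v - degree Y v)"
    using \<open>finite V\<close> \<open>?A \<subseteq> V\<close> by (intro sum.mono_neutral_left) (auto simp: deficient_def)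
  finally show ?thesis .
qed

lemma OPT_le_card_selection:
  "OPT E c \<le> card (complement_selection V E c pick Y) + 2 * card Y"
proof -
  have "simple_graph V Y"
    using graph Y by (auto simp: feasible_def intro: simple_graph_subset)
  have "OPT E c \<le> (\<Sum>v\<in>V. c v)"
    using graph by (rule OPT_le_sum)
  \<comment> \<open>Only an inequality, since \<open>degree Y v\<close> may exceed
    \<open>c v\<close>.\<close>
  also have "\<dots> \<le> (\<Sum>v\<in>V. (c v - degree Y v) + degree Y v)"
    by (intro sum_mono) auto
  also have "\<dots> = card (complement_selection V E c pick Y) + 2 * card Y"
    by (simp only: sum.distrib card_complement_selection sum_degree[OF \<open>simple_graph V Y\<close>])
  finally show ?thesis .
qed

end

theorem theorem1:
  fixes V :: "'a set" and E :: "'a set set" and c :: "'a \<Rightarrow> nat"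
    and es :: "'a set list" and pick :: "'a \<Rightarrow> 'a set set \<Rightarrow> nat \<Rightarrow> 'a set set"
  assumes "connected_graph V E"
    and "\<And>v. v \<in> V \<Longrightarrow> c v \<le> degree E v"
    and "set es = E" and "distinct es"
    and "selector pick"
  shows "feasible E c (pdbep_algorithm V E c es pick) \<and>
         real (card (pdbep_algorithm V E c es pick)) \<ge> real (OPT E c) / 4"
proof -
  define Y where "Y = edge_addition E c es"
  define Z where "Z = complement_selection V E c pick Y"
  have graph: "simple_graph V E"
    using assms(1) by (simp add: connected_graph_def)
  have Y: "feasible E c Y" "\<And>e. e \<in> E - Y \<Longrightarrow> \<not> feasible E c (insert e Y)"
    using edge_addition_maximal[OF simple_graph_finite_edges[OF graph], of c es] assms(3)
    by (auto simp: Y_def)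
  have "feasible E c Z"
    unfolding Z_def using graph assms(2) Y assms(5) by (rule feasible_complement_selection)
  moreover have "OPT E c \<le> card Z + 2 * card Y"
    unfolding Z_def using graph assms(2) Y assms(5) by (rule OPT_le_card_selection)
  moreover have "pdbep_algorithm V E c es pick = (if card Y \<ge> card Z then Y else Z)"
    by (simp add: pdbep_algorithm_def Y_def Z_def Let_def)
  \<comment> \<open>The output has the larger of the two cardinalities, so \<open>OPT E c\<close> is
    at most three times its size.\<close>
  ultimately show ?thesis
    using Y(1) by auto
qed

end
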